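(* Let $P$ be a $\mathcal Q$-determined poset that is co-sober in its Scott topology. Then $P$ is a $\mathcal Q_{\sigma}$-unique poset; that is, for every poset $M$, if $(\mathcal Q(P),\supseteq)$ and $(\mathcal Q(M),\supseteq)$ are order isomorphic, then $P$ and $M$ are order isomorphic.
   Context: For a poset $P$ and $A\subseteq P$, ${\uparrow}A=\{x\in P: x\ge a \text{ for some } a\in A\}$ and ${\uparrow}x={\uparrow}\{x\}$; $A$ is an upper set if $A={\uparrow}A$. A subset $D\subseteq P$ is directed if every finite subset of $D$ (including the empty one) has an upper bound in $D$. A subset $U\subseteq P$ is Scott open if $U={\uparrow}U$ and for every directed $D\subseteq P$ whose supremum exists, $\sup D\in U$ implies $D\cap U\ne\emptyset$; the Scott open sets form the Scott topology. $\mathcal Q(P)$ denotes the set of all compact saturated subsets of $P$ with respect to the Scott topology (saturated means upper set; compact means every open cover has a finite subcover; the empty set is included), ordered by reverse inclusion. Since $\mathcal Q(P)$ is itself a poset (under reverse inclusion), $\mathcal Q(\mathcal Q(P))$ is defined, using the Scott topology of the poset $\mathcal Q(P)$. A poset $P$ is $\mathcal Q$-determined if for any $\mathcal K\in\mathcal Q(\mathcal Q(P))$ whose infimum $\bigwedge\mathcal K$ in $(\mathcal Q(P),\supseteq)$ exists, $\bigwedge\mathcal K=\bigcup\mathcal K$. A nonempty compact saturated subset $K$ of a space is $k$-irreducible if it cannot be written as the union of two proper compact saturated subsets (i.e. two compact saturated sets each properly contained in $K$). A space is co-sober if every $k$-irreducible compact saturated subset is the saturation of a point; for the Scott topology on $P$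 this means it equals ${\uparrow}x$ for some $x\in P$. *)

theory Defs
  imports "HOL-Analysis.Abstract_Topology" "HOL-Algebra.Lattice"
begin

text \<open>
  Posets are \<open>'a gorder\<close> records satisfying the locale predicate \<^const>\<open>partial_order\<close>, so
  that the same definitions apply to a poset and to the posets built from its subsets, and
  the empty poset is not excluded.
\<close>

definition up_set :: "'a gorder \<Rightarrow> 'a set \<Rightarrow> 'a set" where
  "up_set P A = {x \<in> carrier P. \<exists>a\<in>A. a \<sqsubseteq>\<^bsub>P\<^esub> x}"

definition is_upper_set :: "'a gorder \<Rightarrow> 'a set \<Rightarrow> bool" where
  "is_upper_set P A \<longleftrightarrow> A \<subseteq> carrier P \<and> A = up_set P A"

text \<open>The case \<open>F = {}\<close> makes directed sets nonempty.\<close>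

definition directed_in :: "'a gorder \<Rightarrow> 'a set \<Rightarrow> bool" where
  "directed_in P D \<longleftrightarrow> D \<subseteq> carrier P \<and>
     (\<forall>F. finite F \<and> F \<subseteq> D \<longrightarrow> (\<exists>u\<in>D. \<forall>x\<in>F. x \<sqsubseteq>\<^bsub>P\<^esub> u))"

definition scott_open :: "'a gorder \<Rightarrow> 'a set \<Rightarrow> bool" where
  "scott_open P U \<longleftrightarrow> is_upper_set P U \<and>
     (\<forall>D s. directed_in P D \<and> is_lub P s D \<and> s \<in> U \<longrightarrow> D \<inter> U \<noteq> {})"

definition scott_topology :: "'a gorder \<Rightarrow> 'a topology" where
  "scott_topology P = topology (scott_open P)"

definition compact_saturated :: "'a gorder \<Rightarrow> 'a set set" where
  "compact_saturated P = {K. compactin (scott_topology P) K \<and> is_upper_set P K}"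

definition Q_poset :: "'a gorder \<Rightarrow> 'a set gorder" where
  "Q_poset P = \<lparr>carrier = compact_saturated P, eq = (=), le = (\<lambda>K L. L \<subseteq> K)\<rparr>"

definition Q_determined :: "'a gorder \<Rightarrow> bool" where
  "Q_determined P \<longleftrightarrow>
     (\<forall>\<K> \<in> compact_saturated (Q_poset P). \<forall>I. is_glb (Q_poset P) I \<K> \<longrightarrow> I = \<Union>\<K>)"

definition k_irreducible :: "'a gorder \<Rightarrow> 'a set \<Rightarrow> bool" where
  "k_irreducible P K \<longleftrightarrow> K \<in> compact_saturated P \<and> K \<noteq> {} \<and>
     \<not> (\<exists>K1 \<in> compact_saturated P. \<exists>K2 \<in> compact_saturated P.
          K1 \<subset> K \<and> K2 \<subset> K \<and> K = K1 \<union> K2)"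

definition co_sober :: "'a gorder \<Rightarrow> bool" where
  "co_sober P \<longleftrightarrow> (\<forall>K. k_irreducible P K \<longrightarrow> (\<exists>x \<in> carrier P. K = up_set P {x}))"

definition order_isomorphic :: "'a gorder \<Rightarrow> 'b gorder \<Rightarrow> bool" where
  "order_isomorphic P M \<longleftrightarrow> (\<exists>f. order_emb P M f \<and> bij_betw f (carrier P) (carrier M))"

text \<open>
  HOL cannot quantify over types inside a formula, so the type carrying the posets \<open>M\<close> is a
  parameter; a theorem in which \<open>'b\<close> is a free type variable covers posets on every type.
\<close>

definition Q_sigma_unique :: "'b itself \<Rightarrow> 'a gorder \<Rightarrow> bool" where
  "Q_sigma_unique (_ :: 'b itself) P \<longleftrightarrow>
     (\<forall>M :: 'b gorder. partial_order M \<and> order_isomorphic (Q_poset P) (Q_poset M)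
        \<longrightarrow> order_isomorphic P M)"

lemma is_upper_set_iff:
  assumes "partial_order P"
  shows "is_upper_set P A \<longleftrightarrow>
    A \<subseteq> carrier P \<and> (\<forall>a\<in>A. \<forall>x\<in>carrier P. a \<sqsubseteq>\<^bsub>P\<^esub> x \<longrightarrow> x \<in> A)"
proof -
  interpret partial_order P by fact
  have "A \<subseteq> up_set P A" if "A \<subseteq> carrier P" using that le_refl unfolding up_set_def by blast
  moreover have "up_set P A \<subseteq> A \<longleftrightarrow> (\<forall>a\<in>A. \<forall>x\<in>carrier P. a \<sqsubseteq>\<^bsub>P\<^esub> x \<longrightarrow> x \<in> A)"
    by (auto simp: up_set_def)
  ultimately show ?thesis unfolding is_upper_set_def by blast
qed

lemma istopology_scott_open:
  assumes P: "partial_order P"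
  shows "istopology (scott_open P)"
proof -
  have int: "scott_open P (S \<inter> T)" if S: "scott_open P S" and T: "scott_open P T" for S T
    unfolding scott_open_def
  proof (intro conjI allI impI)
    show "is_upper_set P (S \<inter> T)"
      using S T unfolding scott_open_def is_upper_set_iff[OF P] by blast
    fix D s assume D: "directed_in P D \<and> is_lub P s D \<and> s \<in> S \<inter> T"
    then obtain a b where ab: "a \<in> D" "a \<in> S" "b \<in> D" "b \<in> T"
      using S T unfolding scott_open_def by blast
    then have "finite {a, b} \<and> {a, b} \<subseteq> D" by simp
    then obtain u where u: "u \<in> D" "\<forall>x\<in>{a, b}. x \<sqsubseteq>\<^bsub>P\<^esub> u"
      using D unfolding directed_in_def by meson
    have "u \<in> carrier P" using D u unfolding directed_in_def by blast
    then have "u \<in> S \<inter> T"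
      using S T ab u unfolding scott_open_def is_upper_set_iff[OF P] by blast
    then show "D \<inter> (S \<inter> T) \<noteq> {}" using u by blast
  qed
  have Un: "scott_open P (\<Union>\<U>)" if U: "\<forall>U\<in>\<U>. scott_open P U" for \<U>
    unfolding scott_open_def
  proof (intro conjI allI impI)
    show "is_upper_set P (\<Union>\<U>)"
      using U unfolding scott_open_def is_upper_set_iff[OF P] by blast
    fix D s assume "directed_in P D \<and> is_lub P s D \<and> s \<in> \<Union>\<U>"
    then show "D \<inter> \<Union>\<U> \<noteq> {}" using U unfolding scott_open_def by blast
  qed
  show ?thesis using int Un unfolding istopology_def by blast
qed

lemma openin_scott_topology:
  "partial_order P \<Longrightarrow> openin (scott_topology P) U \<longleftrightarrow> scott_open P U"
  by (simp add: scott_topology_def istopology_scott_open)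

lemma topspace_scott_topology:
  assumes P: "partial_order P"
  shows "topspace (scott_topology P) = carrier P"
proof -
  have "scott_open P (carrier P)"
    unfolding scott_open_def
  proof (intro conjI allI impI)
    show "is_upper_set P (carrier P)" unfolding is_upper_set_iff[OF P] by blast
    fix D s assume D: "directed_in P D \<and> is_lub P s D \<and> s \<in> carrier P"
    then have "D \<subseteq> carrier P" by (simp add: directed_in_def)
    moreover have "\<exists>u. u \<in> D"
      using D unfolding directed_in_def by (metis empty_subsetI finite.emptyI)
    ultimately show "D \<inter> carrier P \<noteq> {}" by blast
  qed
  moreover have "U \<subseteq> carrier P" if "scott_open P U" for U
    using that unfolding scott_open_def is_upper_set_def by blast
  ultimately show ?thesis
    unfolding topspace_def openin_scott_topology[OF P] by blast
qed

lemma partial_order_Q_poset: "partial_order (Q_poset P)"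
  by unfold_locales (auto simp: Q_poset_def)

end

theory Submission
  imports Defs
begin

text \<open>
  In \<open>Q(P)\<close>, ordered by reverse inclusion, binary meets are unions, so \<open>k\<close>-irreducibility is a
  notion of the order of \<open>Q(P)\<close> alone: a \<open>k\<close>-irreducible set is an element that is not the greatest
  one \<open>{}\<close> and is not a meet of two other elements (lemma \<open>k_irreducible_iso\<close>). Every set
  \<open>\<up>x\<close> is \<open>k\<close>-irreducible, and \<open>x \<mapsto> \<up>x\<close> embeds \<open>P\<close> into \<open>Q(P)\<close>. Hence a co-sober
  poset can be recovered from \<open>Q(P)\<close> as the poset of its \<open>k\<close>-irreducible elements, and two co-sober
  posets with isomorphic \<open>Q\<close> are isomorphic (lemma \<open>co_sober_order_isomorphic\<close>).

  It remains to see that co-sobriety passes from \<open>P\<close> to \<open>M\<close>, and this is where \<open>P\<close> being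
  \<open>Q\<close>-determined enters (lemma \<open>co_sober_transfer\<close>). Let \<open>K\<close> be \<open>k\<close>-irreducible in \<open>M\<close>. The map
  \<open>m \<mapsto> \<up>m\<close> is Scott continuous, so the upper set \<open>\<K>\<close> generated in \<open>Q(M)\<close> by the sets \<open>\<up>m\<close> with
  \<open>m \<in> K\<close> is compact, and its infimum is \<open>\<Union>\<K> = K\<close>. An isomorphism \<open>g\<close> from \<open>Q(M)\<close> to \<open>Q(P)\<close> carries \<open>\<K>\<close>
  to a compact saturated family with infimum \<open>g K\<close>, which is \<open>\<up>x\<close> for some \<open>x\<close> as \<open>P\<close> is co-sober.
  Since \<open>P\<close> is \<open>Q\<close>-determined, this infimum is the union, so \<open>x\<close> lies in some member of the
  family; that member is then all of \<open>\<up>x\<close>. Thus the infimum is attained, \<open>K\<close> is itself a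
  member of \<open>\<K>\<close>, and so \<open>K \<subseteq> \<up>m\<close> for some \<open>m \<in> K\<close>, that is, \<open>K = \<up>m\<close>.
\<close>

section \<open>Order isomorphisms\<close>

lemma order_emb_inv_into:
  assumes f: "order_emb A B f" and bij: "bij_betw f (carrier A) (carrier B)"
  shows "order_emb B A (inv_into (carrier A) f)"
  unfolding order_emb_def
proof (intro conjI ballI)
  show "weak_partial_order B" "weak_partial_order A" using f by (auto simp: order_emb_def)
  fix x y assume xy: "x \<in> carrier B" "y \<in> carrier B"
  let ?g = "inv_into (carrier A) f"
  have "?g x \<in> carrier A" "?g y \<in> carrier A" "f (?g x) = x" "f (?g y) = y"
    using xy bij by (auto simp: bij_betw_def inv_into_into f_inv_into_f)
  then show "?g x \<sqsubseteq>\<^bsub>A\<^esub> ?g y \<longleftrightarrow> x \<sqsubseteq>\<^bsub>B\<^esub> y" using f unfolding order_emb_def by metis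
qed

lemma is_lub_order_iso:
  assumes f: "order_emb A B f" and bij: "bij_betw f (carrier A) (carrier B)"
    and S: "S \<subseteq> carrier A" and lub: "is_lub A s S"
  shows "is_lub B (f s) (f ` S)"
proof -
  have surj: "carrier B = f ` carrier A" using bij by (simp add: bij_betw_def)
  have emb: "f x \<sqsubseteq>\<^bsub>B\<^esub> f y \<longleftrightarrow> x \<sqsubseteq>\<^bsub>A\<^esub> y" if "x \<in> carrier A" "y \<in> carrier A" for x y
    using f that by (simp add: order_emb_def)
  have key: "f x \<in> Upper B (f ` S) \<longleftrightarrow> x \<in> Upper A S" if "x \<in> carrier A" for x
  proof -
    have "f ` S \<inter> carrier B = f ` S" "S \<inter> carrier A = S" using S surj by auto
    then show ?thesis using that emb S unfolding Upper_def by (auto simp: surj S[THEN subsetD])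
  qed
  have s: "s \<in> Upper A S" "s \<in> carrier A" and s_le: "\<And>x. x \<in> Upper A S \<Longrightarrow> s \<sqsubseteq>\<^bsub>A\<^esub> x"
    using lub by (auto simp: least_def Upper_def)
  show ?thesis
    unfolding least_def
  proof (intro conjI ballI)
    show "Upper B (f ` S) \<subseteq> carrier B" by (auto simp: Upper_def)
    show "f s \<in> Upper B (f ` S)" using key s by simp
    fix y assume y: "y \<in> Upper B (f ` S)"
    then have "y \<in> f ` carrier A" by (auto simp: Upper_def surj)
    then obtain x where x: "x \<in> carrier A" "y = f x" by blast
    then have "s \<sqsubseteq>\<^bsub>A\<^esub> x" using y key s_le by simp
    then show "f s \<sqsubseteq>\<^bsub>B\<^esub> y" using emb s x by simp
  qed
qed

lemma is_glb_order_iso: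
  assumes f: "order_emb A B f" and bij: "bij_betw f (carrier A) (carrier B)"
    and S: "S \<subseteq> carrier A" and glb: "is_glb A s S"
  shows "is_glb B (f s) (f ` S)"
proof -
  have "order_emb (inv_gorder A) (inv_gorder B) f"
    using f by (simp add: order_emb_def weak_partial_order.dual_weak_order)
  from is_lub_order_iso[OF this, of S s] show ?thesis using bij S glb by simp
qed

section \<open>Scott continuity and compact saturated sets\<close>

lemma continuous_map_scott:
  assumes A: "partial_order A" and B: "partial_order B"
    and f: "f ` carrier A \<subseteq> carrier B"
    and mono: "\<And>x y. \<lbrakk>x \<in> carrier A; y \<in> carrier A; x \<sqsubseteq>\<^bsub>A\<^esub> y\<rbrakk> \<Longrightarrow> f x \<sqsubseteq>\<^bsub>B\<^esub> f y"
    and lub: "\<And>D s. \<lbrakk>directed_in A D; is_lub A s D\<rbrakk> \<Longrightarrow> is_lub B (f s) (f ` D)"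
  shows "continuous_map (scott_topology A) (scott_topology B) f"
proof -
  have "scott_open A {x \<in> carrier A. f x \<in> U}" if U: "scott_open B U" for U
    unfolding scott_open_def
  proof (intro conjI allI impI)
    have "\<forall>a\<in>U. \<forall>y\<in>carrier B. a \<sqsubseteq>\<^bsub>B\<^esub> y \<longrightarrow> y \<in> U"
      using U by (simp add: scott_open_def is_upper_set_iff[OF B])
    then show "is_upper_set A {x \<in> carrier A. f x \<in> U}"
      using f mono by (auto simp: is_upper_set_iff[OF A] image_subset_iff)
    fix D s assume D: "directed_in A D \<and> is_lub A s D \<and> s \<in> {x \<in> carrier A. f x \<in> U}"
    then have DA: "D \<subseteq> carrier A" by (simp add: directed_in_def)
    have "directed_in B (f ` D)"
      unfolding directed_in_def
    proof (intro conjI allI impI)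
      show "f ` D \<subseteq> carrier B" using DA f by blast
      fix F assume "finite F \<and> F \<subseteq> f ` D"
      then obtain G where G: "finite G" "G \<subseteq> D" "F = f ` G"
        by (meson finite_subset_image)
      then obtain u where "u \<in> D" "\<forall>x\<in>G. x \<sqsubseteq>\<^bsub>A\<^esub> u"
        using D unfolding directed_in_def by meson
      then show "\<exists>u\<in>f ` D. \<forall>x\<in>F. x \<sqsubseteq>\<^bsub>B\<^esub> u" using G DA mono by blast
    qed
    then have "f ` D \<inter> U \<noteq> {}" using D lub U unfolding scott_open_def by blast
    then show "D \<inter> {x \<in> carrier A. f x \<in> U} \<noteq> {}" using DA by blast
  qed
  then show ?thesis
    using f by (simp add: continuous_map openin_scott_topology A B topspace_scott_topology)
qed

text \<open>Scott open sets are upper sets, so a Scott open cover of \<open>S\<close> also covers \<open>\<up>S\<close>.\<close>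

lemma up_set_in_compact_saturated:
  assumes P: "partial_order P" and S: "compactin (scott_topology P) S"
  shows "up_set P S \<in> compact_saturated P"
proof -
  interpret partial_order P by fact
  have SP: "S \<subseteq> carrier P"
    using compactin_subset_topspace[OF S] by (simp add: topspace_scott_topology P)
  have upper: "is_upper_set P (up_set P S)"
    unfolding is_upper_set_iff[OF P] up_set_def using SP le_trans by blast
  have sub: "S \<subseteq> up_set P S" using SP le_refl unfolding up_set_def by blast
  have cover: "up_set P S \<subseteq> \<Union>\<U>" if U: "\<forall>U\<in>\<U>. openin (scott_topology P) U" "S \<subseteq> \<Union>\<U>" for \<U>
  proof
    fix x assume "x \<in> up_set P S"
    then obtain a where a: "x \<in> carrier P" "a \<in> S" "a \<sqsubseteq>\<^bsub>P\<^esub> x" by (auto simp: up_set_def)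
    then obtain V where V: "V \<in> \<U>" "a \<in> V" using U(2) by blast
    then have "is_upper_set P V" using U(1) by (simp add: openin_scott_topology P scott_open_def)
    then have "x \<in> V" using a V unfolding is_upper_set_iff[OF P] by blast
    then show "x \<in> \<Union>\<U>" using V by blast
  qed
  have "compactin (scott_topology P) (up_set P S)"
    unfolding compactin_def
  proof (intro conjI allI impI)
    show "up_set P S \<subseteq> topspace (scott_topology P)"
      by (auto simp: topspace_scott_topology P up_set_def)
    fix \<U> assume U: "(\<forall>U\<in>\<U>. openin (scott_topology P) U) \<and> up_set P S \<subseteq> \<Union>\<U>"
    then obtain \<F> where "finite \<F>" "\<F> \<subseteq> \<U>" "S \<subseteq> \<Union>\<F>"
      using S sub unfolding compactin_def by (meson order_trans)
    then show "\<exists>\<F>. finite \<F> \<and> \<F> \<subseteq> \<U> \<and> up_set P S \<subseteq> \<Union>\<F>"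
      using cover U by (meson subsetD)
  qed
  then show ?thesis using upper by (simp add: compact_saturated_def)
qed

lemma principal_in_compact_saturated:
  assumes "partial_order P" "x \<in> carrier P"
  shows "up_set P {x} \<in> compact_saturated P"
  using assms
  by (intro up_set_in_compact_saturated finite_imp_compactin) (auto simp: topspace_scott_topology)

lemma principal_subset_iff:
  assumes "partial_order P" "x \<in> carrier P" "is_upper_set P K"
  shows "up_set P {x} \<subseteq> K \<longleftrightarrow> x \<in> K"
proof -
  interpret partial_order P by fact
  show ?thesis using assms unfolding is_upper_set_iff[OF assms(1)] by (auto simp: up_set_def)
qed

lemma principal_subset_principal_iff:
  assumes P: "partial_order P" and "x \<in> carrier P" "y \<in> carrier P"
  shows "up_set P {y} \<subseteq> up_set P {x} \<longleftrightarrow> x \<sqsubseteq>\<^bsub>P\<^esub> y"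
proof -
  have "is_upper_set P (up_set P {x})"
    using principal_in_compact_saturated[OF P] assms by (simp add: compact_saturated_def)
  from principal_subset_iff[OF P _ this] show ?thesis using assms by (simp add: up_set_def)
qed

lemma compact_saturated_Un:
  assumes P: "partial_order P"
    and "K \<in> compact_saturated P" "L \<in> compact_saturated P"
  shows "K \<union> L \<in> compact_saturated P"
  using assms unfolding compact_saturated_def
  by (auto simp: is_upper_set_iff[OF P] intro: compactin_Un)

lemma compact_saturated_order_iso_image:
  assumes A: "partial_order A" and B: "partial_order B"
    and f: "order_emb A B f" and bij: "bij_betw f (carrier A) (carrier B)"
    and K: "K \<in> compact_saturated A"
  shows "f ` K \<in> compact_saturated B"
proof -
  have surj: "carrier B = f ` carrier A" using bij by (simp add: bij_betw_def)
  have emb: "f x \<sqsubseteq>\<^bsub>B\<^esub> f y \<longleftrightarrow> x \<sqsubseteq>\<^bsub>A\<^esub> y" if "x \<in> carrier A" "y \<in> carrier A" for x y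
    using f that by (simp add: order_emb_def)
  have "continuous_map (scott_topology A) (scott_topology B) f"
  proof (rule continuous_map_scott[OF A B])
    show "is_lub B (f s) (f ` D)" if "directed_in A D" "is_lub A s D" for D s
      using is_lub_order_iso[OF f bij _ that(2)] that(1) by (simp add: directed_in_def)
  qed (use surj emb in auto)
  then have "compactin (scott_topology B) (f ` K)"
    using K image_compactin by (fastforce simp: compact_saturated_def)
  moreover have "is_upper_set B (f ` K)"
    unfolding is_upper_set_iff[OF B]
  proof (intro conjI ballI impI)
    have K': "K \<subseteq> carrier A" "\<forall>a\<in>K. \<forall>x\<in>carrier A. a \<sqsubseteq>\<^bsub>A\<^esub> x \<longrightarrow> x \<in> K"
      using K by (auto simp: compact_saturated_def is_upper_set_iff[OF A])
    then show "f ` K \<subseteq> carrier B" using surj by blast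
    fix b y assume "b \<in> f ` K" "y \<in> carrier B" "b \<sqsubseteq>\<^bsub>B\<^esub> y"
    then obtain a x where ax: "a \<in> K" "x \<in> carrier A" "y = f x" "f a \<sqsubseteq>\<^bsub>B\<^esub> f x"
      unfolding surj by auto
    then have "a \<sqsubseteq>\<^bsub>A\<^esub> x" using emb K' by blast
    then show "y \<in> f ` K" using ax K' by blast
  qed
  ultimately show ?thesis by (simp add: compact_saturated_def)
qed

section \<open>The poset of compact saturated sets\<close>

lemma Q_poset_simps [simp]:
  "carrier (Q_poset P) = compact_saturated P"
  "K \<sqsubseteq>\<^bsub>Q_poset P\<^esub> L \<longleftrightarrow> L \<subseteq> K"
  by (auto simp: Q_poset_def)

text \<open>
  This expresses unions of compact saturated sets as infima, which order isomorphisms preserve. If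
  the union is not compact, the infimum is only known to contain it, and the two can differ.
\<close>

lemma is_glb_Q_poset_iff:
  assumes "\<K> \<subseteq> compact_saturated P" "\<Union>\<K> \<in> compact_saturated P"
  shows "is_glb (Q_poset P) I \<K> \<longleftrightarrow> I = \<Union>\<K>"
proof -
  have "Lower (Q_poset P) \<K> = {L \<in> compact_saturated P. \<Union>\<K> \<subseteq> L}"
    using assms(1) by (auto simp: Lower_def)
  then show ?thesis using assms(2) by (auto simp: greatest_def)
qed

text \<open>
  When \<open>s\<close> is the supremum of \<open>D\<close>, the set \<open>\<up>s\<close> is the intersection of the sets \<open>\<up>d\<close> with
  \<open>d \<in> D\<close>. As this intersection is compact saturated, it is their supremum under reverse inclusion.
\<close>

lemma continuous_map_principal:
  assumes P: "partial_order P"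
  shows "continuous_map (scott_topology P) (scott_topology (Q_poset P)) (\<lambda>x. up_set P {x})"
proof (rule continuous_map_scott[OF P partial_order_Q_poset])
  show "(\<lambda>x. up_set P {x}) ` carrier P \<subseteq> carrier (Q_poset P)"
    using principal_in_compact_saturated[OF P] by auto
  show "up_set P {x} \<sqsubseteq>\<^bsub>Q_poset P\<^esub> up_set P {y}"
    if "x \<in> carrier P" "y \<in> carrier P" "x \<sqsubseteq>\<^bsub>P\<^esub> y" for x y
    using that by (simp add: principal_subset_principal_iff[OF P])
  fix D s assume D: "directed_in P D" and s: "is_lub P s D"
  have DP: "D \<subseteq> carrier P" using D by (simp add: directed_in_def)
  have sP: "s \<in> carrier P" and ub: "\<And>d. d \<in> D \<Longrightarrow> d \<sqsubseteq>\<^bsub>P\<^esub> s"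
    and least: "\<And>u. \<lbrakk>u \<in> carrier P; \<forall>d\<in>D. d \<sqsubseteq>\<^bsub>P\<^esub> u\<rbrakk> \<Longrightarrow> s \<sqsubseteq>\<^bsub>P\<^esub> u"
    using s DP by (auto simp: least_def Upper_def)
  have low: "up_set P {s} \<subseteq> up_set P {d}" if "d \<in> D" for d
    using that DP sP ub principal_subset_principal_iff[OF P, of d s] by blast
  have "L \<subseteq> up_set P {s}"
    if L: "L \<in> compact_saturated P" "\<And>d. d \<in> D \<Longrightarrow> L \<subseteq> up_set P {d}" for L
  proof
    fix x assume "x \<in> L"
    then have "x \<in> carrier P" "\<forall>d\<in>D. d \<sqsubseteq>\<^bsub>P\<^esub> x"
      using L by (auto simp: compact_saturated_def is_upper_set_def up_set_def)
    then show "x \<in> up_set P {s}" using least by (simp add: up_set_def)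
  qed
  moreover have "Upper (Q_poset P) ((\<lambda>x. up_set P {x}) ` D)
      = {L \<in> compact_saturated P. \<forall>d\<in>D. L \<subseteq> up_set P {d}}"
  proof -
    have "(\<lambda>x. up_set P {x}) ` D \<inter> compact_saturated P = (\<lambda>x. up_set P {x}) ` D"
      using principal_in_compact_saturated[OF P] DP by auto
    then show ?thesis unfolding Upper_def by auto
  qed
  ultimately show "is_lub (Q_poset P) (up_set P {s}) ((\<lambda>x. up_set P {x}) ` D)"
    using low principal_in_compact_saturated[OF P sP] by (simp add: least_def)
qed

section \<open>Irreducible compact saturated sets\<close>

text \<open>A compact saturated part of \<open>\<up>x\<close> that contains \<open>x\<close> is all of \<open>\<up>x\<close>.\<close>

lemma k_irreducible_principal:
  assumes P: "partial_order P" and x: "x \<in> carrier P"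
  shows "k_irreducible P (up_set P {x})"
proof -
  have Q: "up_set P {x} \<in> compact_saturated P" using principal_in_compact_saturated[OF P x] .
  then have "x \<in> up_set P {x}"
    using principal_subset_iff[OF P x] by (auto simp: compact_saturated_def)
  moreover have "up_set P {x} \<subseteq> K" if "K \<in> compact_saturated P" "x \<in> K" for K
    using that principal_subset_iff[OF P x] by (auto simp: compact_saturated_def)
  ultimately show ?thesis using Q unfolding k_irreducible_def by blast
qed

text \<open>
  A decomposition \<open>f K = L1 \<union> L2\<close> says that \<open>f K\<close> is the meet of \<open>L1\<close> and \<open>L2\<close>. The inverse of \<open>f\<close>
  moves this meet back to \<open>Q(P)\<close>, where it is again a union, now of \<open>K\<close>. Nonemptiness is kept because
  \<open>{}\<close> is the greatest element.
\<close>

lemma k_irreducible_iso: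
  assumes P: "partial_order P" and M: "partial_order M"
    and f: "order_emb (Q_poset P) (Q_poset M) f"
    and bij: "bij_betw f (compact_saturated P) (compact_saturated M)"
    and K: "k_irreducible P K"
  shows "k_irreducible M (f K)"
proof -
  let ?g = "inv_into (compact_saturated P) f"
  have g: "order_emb (Q_poset M) (Q_poset P) ?g"
    using order_emb_inv_into[OF f] bij by simp
  have bijg: "bij_betw ?g (compact_saturated M) (compact_saturated P)"
    using bij by (rule bij_betw_inv_into)
  have KQ: "K \<in> compact_saturated P" and "K \<noteq> {}" using K by (auto simp: k_irreducible_def)
  have fK: "f K \<in> compact_saturated M" and gfK: "?g (f K) = K"
    using KQ bij by (auto simp: bij_betw_def)
  have "f K \<noteq> {}"
  proof
    have E: "{} \<in> compact_saturated P"
      by (simp add: compact_saturated_def is_upper_set_def up_set_def)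
    assume "f K = {}"
    then have "f {} \<sqsubseteq>\<^bsub>Q_poset M\<^esub> f K" by simp
    then have "{} \<sqsubseteq>\<^bsub>Q_poset P\<^esub> K" using f E KQ unfolding order_emb_def by simp
    with \<open>K \<noteq> {}\<close> show False by simp
  qed
  moreover have "f K = L1 \<or> f K = L2"
    if L: "L1 \<in> compact_saturated M" "L2 \<in> compact_saturated M" "f K = L1 \<union> L2" for L1 L2
  proof -
    have gL: "?g L1 \<in> compact_saturated P" "?g L2 \<in> compact_saturated P"
      using L bijg by (auto simp: bij_betw_def)
    have "is_glb (Q_poset M) (f K) {L1, L2}"
      using L fK by (subst is_glb_Q_poset_iff) auto
    then have "is_glb (Q_poset P) (?g (f K)) (?g ` {L1, L2})"
      using L bijg by (intro is_glb_order_iso[OF g]) auto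
    then have "K = ?g L1 \<union> ?g L2"
      using gL compact_saturated_Un[OF P gL] gfK
      by (subst (asm) is_glb_Q_poset_iff) auto
    then have "K = ?g L1 \<or> K = ?g L2"
      using K gL unfolding k_irreducible_def by blast
    then show ?thesis using L bij by (metis bij_betw_inv_into_right)
  qed
  ultimately show ?thesis using fK unfolding k_irreducible_def by blast
qed

text \<open>
  Compact saturated families and their infima are carried along \<open>g\<close>, but unions need not be. Being
  \<open>Q\<close>-determined supplies the union on the side of \<open>P\<close>, and the point \<open>x\<close> with \<open>g K = \<up>x\<close> then
  picks out one member of the family that attains the infimum.
\<close>

lemma co_sober_transfer:
  assumes P: "partial_order P" and M: "partial_order M"
    and det: "Q_determined P" and sober: "co_sober P"
    and g: "order_emb (Q_poset M) (Q_poset P) g"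
    and bij: "bij_betw g (compact_saturated M) (compact_saturated P)"
  shows "co_sober M"
  unfolding co_sober_def
proof (intro allI impI)
  fix K assume K: "k_irreducible M K"
  then have KQ: "K \<in> compact_saturated M" by (simp add: k_irreducible_def)
  then have Kup: "is_upper_set M K" and KM: "K \<subseteq> carrier M"
    by (auto simp: compact_saturated_def is_upper_set_def)
  obtain x where x: "x \<in> carrier P" and gK: "g K = up_set P {x}"
    using sober k_irreducible_iso[OF M P g bij K] unfolding co_sober_def by blast
  define \<K> where "\<K> = up_set (Q_poset M) ((\<lambda>m. up_set M {m}) ` K)"
  have \<K>_iff: "L \<in> \<K> \<longleftrightarrow> L \<in> compact_saturated M \<and> (\<exists>m\<in>K. L \<subseteq> up_set M {m})" for L
    by (auto simp: \<K>_def up_set_def[of "Q_poset M"])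
  have \<K>: "\<K> \<in> compact_saturated (Q_poset M)"
    unfolding \<K>_def
    using KQ image_compactin[OF _ continuous_map_principal[OF M]]
    by (intro up_set_in_compact_saturated partial_order_Q_poset) (simp add: compact_saturated_def)
  have principal: "up_set M {m} \<in> \<K>" "m \<in> up_set M {m}" "up_set M {m} \<subseteq> K" if "m \<in> K" for m
    using that KM principal_in_compact_saturated[OF M, of m] principal_subset_iff[OF M, of m]
      Kup by (auto simp: \<K>_iff compact_saturated_def)
  have U: "\<Union>\<K> = K" using principal \<K>_iff by blast
  have sub: "\<K> \<subseteq> compact_saturated M" using \<K>_iff by blast
  have "is_glb (Q_poset M) K \<K>"
    using is_glb_Q_poset_iff[OF sub] U KQ by simp
  then have "is_glb (Q_poset P) (g K) (g ` \<K>)"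
    using is_glb_order_iso[OF g] bij sub by simp
  moreover have "g ` \<K> \<in> compact_saturated (Q_poset P)"
    using compact_saturated_order_iso_image[OF partial_order_Q_poset partial_order_Q_poset g _ \<K>] bij
    by simp
  ultimately have glb: "g K = \<Union>(g ` \<K>)" using det unfolding Q_determined_def by blast
  \<comment> \<open>The member of the family that contains \<open>x\<close> contains \<open>\<up>x = g K\<close>, the union of them all.\<close>
  have "x \<in> g K"
    unfolding gK using principal_in_compact_saturated[OF P x] principal_subset_iff[OF P x]
    by (simp add: compact_saturated_def flip: principal_subset_iff[OF P x])
  then obtain L where L: "L \<in> \<K>" "x \<in> g L" using glb by blast
  have LQ: "L \<in> compact_saturated M" using L \<K>_iff by blast
  then have "g L \<in> compact_saturated P" using bij by (auto simp: bij_betw_def)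
  then have "is_upper_set P (g L)" by (simp add: compact_saturated_def)
  then have "g K \<subseteq> g L" using L gK principal_subset_iff[OF P x] by simp
  moreover have "g L \<subseteq> g K" using glb L by blast
  ultimately have "K = L" using bij KQ LQ by (auto simp: bij_betw_def inj_on_def)
  then obtain m where m: "m \<in> K" "K \<subseteq> up_set M {m}" using L \<K>_iff by blast
  have "K = up_set M {m}" using m(2) principal(3)[OF m(1)] by (rule equalityI)
  then show "\<exists>m\<in>carrier M. K = up_set M {m}" using m(1) KM by blast
qed

section \<open>Recovering a co-sober poset\<close>

text \<open>
  On both sides the points correspond to the \<open>k\<close>-irreducible sets, so \<open>f\<close> induces a map \<open>h\<close> with
  \<open>f (\<up>x) = \<up>(h x)\<close>. Co-sobriety of \<open>M\<close> makes \<open>h\<close> exist, that of \<open>P\<close> makes it surjective.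
\<close>

lemma co_sober_order_isomorphic:
  assumes P: "partial_order P" and M: "partial_order M"
    and sober: "co_sober P" "co_sober M"
    and f: "order_emb (Q_poset P) (Q_poset M) f"
    and bij: "bij_betw f (compact_saturated P) (compact_saturated M)"
  shows "order_isomorphic P M"
proof -
  interpret P: partial_order P by fact
  interpret M: partial_order M by fact
  let ?g = "inv_into (compact_saturated P) f"
  have g: "order_emb (Q_poset M) (Q_poset P) ?g"
    using order_emb_inv_into[OF f] bij by simp
  have bijg: "bij_betw ?g (compact_saturated M) (compact_saturated P)"
    using bij by (rule bij_betw_inv_into)
  have "\<forall>x\<in>carrier P. \<exists>m\<in>carrier M. f (up_set P {x}) = up_set M {m}"
    using k_irreducible_iso[OF P M f bij] k_irreducible_principal[OF P] sober(2)
    unfolding co_sober_def by blast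
  then obtain h where h: "\<And>x. x \<in> carrier P \<Longrightarrow> h x \<in> carrier M"
    "\<And>x. x \<in> carrier P \<Longrightarrow> f (up_set P {x}) = up_set M {h x}"
    by metis
  have emb: "h x \<sqsubseteq>\<^bsub>M\<^esub> h y \<longleftrightarrow> x \<sqsubseteq>\<^bsub>P\<^esub> y" if "x \<in> carrier P" "y \<in> carrier P" for x y
  proof -
    have "up_set M {h y} \<subseteq> up_set M {h x} \<longleftrightarrow> up_set P {y} \<subseteq> up_set P {x}"
      using f that principal_in_compact_saturated[OF P]
      unfolding order_emb_def by (simp flip: h(2))
    then show ?thesis using that h by (simp add: principal_subset_principal_iff P M)
  qed
  have "inj_on h (carrier P)"
  proof (rule inj_onI)
    fix x y assume xy: "x \<in> carrier P" "y \<in> carrier P" "h x = h y"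
    then have "x \<sqsubseteq>\<^bsub>P\<^esub> y" "y \<sqsubseteq>\<^bsub>P\<^esub> x" using emb h M.le_refl by metis+
    then show "x = y" using xy P.le_antisym by blast
  qed
  moreover have "h ` carrier P = carrier M"
  proof
    show "carrier M \<subseteq> h ` carrier P"
    proof
      fix m assume m: "m \<in> carrier M"
      then obtain x where x: "x \<in> carrier P" "?g (up_set M {m}) = up_set P {x}"
        using k_irreducible_iso[OF M P g bijg k_irreducible_principal[OF M m]] sober(1)
        unfolding co_sober_def by blast
      then have "up_set M {m} = up_set M {h x}"
        using h(2)[OF x(1)] bij_betw_inv_into_right[OF bij principal_in_compact_saturated[OF M m]]
        by simp
      then have "m \<sqsubseteq>\<^bsub>M\<^esub> h x" "h x \<sqsubseteq>\<^bsub>M\<^esub> m"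
        using m h x by (simp_all flip: principal_subset_principal_iff[OF M])
      then show "m \<in> h ` carrier P" using m h x M.le_antisym by blast
    qed
  qed (use h in blast)
  moreover have "order_emb P M h"
    using emb P.weak_partial_order_axioms M.weak_partial_order_axioms by (simp add: order_emb_def)
  ultimately show ?thesis unfolding order_isomorphic_def bij_betw_def by blast
qed

theorem theorem3p19:
  fixes P :: "'a gorder"
  assumes "partial_order P"
    and "Q_determined P"
    and "co_sober P"
  shows "Q_sigma_unique TYPE('b) P"
  unfolding Q_sigma_unique_def
proof (intro allI impI)
  fix M :: "'b gorder"
  assume "partial_order M \<and> order_isomorphic (Q_poset P) (Q_poset M)"
  then obtain f where M: "partial_order M"
    and f: "order_emb (Q_poset P) (Q_poset M) f"
    and bij: "bij_betw f (compact_saturated P) (compact_saturated M)"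
    unfolding order_isomorphic_def by auto
  have "co_sober M"
    using co_sober_transfer[OF assms(1) M assms(2,3)]
      order_emb_inv_into[OF f] bij_betw_inv_into[OF bij] bij by simp
  then show "order_isomorphic P M"
    using co_sober_order_isomorphic[OF assms(1) M assms(3) _ f bij] by blast
qed

end
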